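(* Consider an $(\mathsf{H},\mathsf{r},\mathsf{M},\mathsf{N})$ combination network, and let $\mathsf{K}_i=\binom{\mathsf{H}-i}{\mathsf{r}-i}$ for $i\in\{0,1,\ldots,\mathsf{r}\}$. For every integer $g$ with $1\le g\le \mathsf{K}_1$, a coded caching gain of $g$ is achievable with cache size $$\mathsf{M}=\mathsf{N}\,\frac{\sum_{a=1}^{\mathsf{r}}\binom{\mathsf{r}}{a}\binom{\mathsf{K}_a-1}{g-2}(-1)^{a-1}}{\sum_{a=1}^{\mathsf{r}}\binom{\mathsf{r}}{a}\binom{\mathsf{K}_a}{g-1}(-1)^{a-1}}.$$ That is, for this value of $\mathsf{M}$ there is a caching scheme (placement and delivery) whose max-link load is $$\mathsf{R}=\frac{1}{g}\cdot\frac{\mathsf{K}_1\,(1-\mathsf{M}/\mathsf{N})}{\mathsf{r}}.$$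
   Context: Convention: $\binom{x}{y}=0$ if $x<0$ or $y<0$ or $x<y$. Combination network. Let $\mathsf{H},\mathsf{r},\mathsf{N}$ be positive integers with $\mathsf{r}\le\mathsf{H}$, and let $\mathsf{M}\in[0,\mathsf{N}]$. In an $(\mathsf{H},\mathsf{r},\mathsf{M},\mathsf{N})$ combination network, a server has $\mathsf{N}$ files $F_1,\ldots,F_{\mathsf{N}}$, each consisting of $\mathsf{B}$ i.i.d. uniformly distributed bits. The server is connected to $\mathsf{H}$ relays (without caches) through $\mathsf{H}$ error-free orthogonal links. There are $\mathsf{K}=\mathsf{K}_0=\binom{\mathsf{H}}{\mathsf{r}}$ users, in bijection with the $\mathsf{r}$-element subsets of the set of relays $\{1,\ldots,\mathsf{H}\}$. User $k$ is connected, through $\mathsf{r}$ error-free orthogonal links, to the relays in its subset $\mathcal{H}_k$. Let $\mathcal{U}_h$ denote the set of users connected to relay $h$; then $|\mathcal{U}_h|=\mathsf{K}_1$. Each user has a cache of size $\mathsf{M}\mathsf{B}$ bits. Caching scheme. In the placement phase, user $k$ stores in its cache content $Z_k$, of at most $\mathsf{M}\mathsf{B}$ bits, an arbitrary (possibly coded) function of the $\mathsf{N}$ files, chosen without knowledge of the demands. Let $\mathbf{Z}=(Z_1,\ldots,Z_{\mathsf{K}})$. In the delivery phase, user $k$ requests file $d_k\in\{1,\ldots,\mathsf{N}\}$, and the demand vector $\mathbf{d}=(d_1,\ldots,d_{\mathsf{K}})$ is revealed to all nodes. Given $(\mathbf{d},\mathbf{Z})$, the server (which knows all the files) sends to relay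 $h$ a message $X_h$ of $\mathsf{B}\,\mathsf{R}_h(\mathbf{d},\mathbf{Z})$ bits. Relay $h$ then sends to each user $k\in\mathcal{U}_h$ a message $X_{h\to k}$, computed from $X_h$ (and $\mathbf{d}$), of $\mathsf{B}\,\mathsf{R}_{h\to k}(\mathbf{d},\mathbf{Z})$ bits. User $k$ must recover $F_{d_k}$ from $Z_k$ and $(X_{h\to k}:h\in\mathcal{H}_k)$ with high probability as $\mathsf{B}\to\infty$ (a scheme is thus understood as a family of such placement and delivery functions along a sequence of file sizes $\mathsf{B}\to\infty$). Max-link load of a scheme: the maximum, over all demand vectors $\mathbf{d}\in\{1,\ldots,\mathsf{N}\}^{\mathsf{K}}$, of $$\max\Big\{\max_{h}\mathsf{R}_h(\mathbf{d},\mathbf{Z}),\ \max_{h,\;k\in\mathcal{U}_h}\mathsf{R}_{h\to k}(\mathbf{d},\mathbf{Z})\Big\}.$$ Coded caching gain: a scheme with max-link load $\mathsf{R}$ attains a coded caching gain of $g$ if $\mathsf{R}=\mathsf{R}_{\text{routing}}/g$, where $\mathsf{R}_{\text{routing}}=\frac{\mathsf{K}(1-\mathsf{M}/\mathsf{N})}{\mathsf{H}}=\frac{\mathsf{K}_1(1-\mathsf{M}/\mathsf{N})}{\mathsf{r}}$. *)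

theory Defs
  imports "HOL-Probability.Probability"
begin

definition binom0 :: "int \<Rightarrow> int \<Rightarrow> nat" where
  "binom0 x y = (if x < 0 \<or> y < 0 \<or> x < y then 0 else nat x choose nat y)"

definition Kc :: "nat \<Rightarrow> nat \<Rightarrow> nat \<Rightarrow> nat" where
  "Kc H r i = (H - i) choose (r - i)"

definition combination_network :: "nat \<Rightarrow> nat \<Rightarrow> real \<Rightarrow> nat \<Rightarrow> bool" where
  "combination_network H r M N \<longleftrightarrow> 0 < H \<and> 0 < r \<and> 0 < N \<and> r \<le> H \<and> 0 \<le> M \<and> M \<le> real N"

type_synonym relay = nat

(* A user is identified with the set of relays it is connected to, so the set of relays
   of user k is k itself. *)
type_synonym user = "nat set"

type_synonym bits = "bool list"
type_synonym library = "nat \<Rightarrow> bits"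
type_synonym demand = "user \<Rightarrow> nat"

definition relays :: "nat \<Rightarrow> relay set" where
  "relays H = {1..H}"

definition users :: "nat \<Rightarrow> nat \<Rightarrow> user set" where
  "users H r = {k. k \<subseteq> relays H \<and> card k = r}"

definition users_of :: "nat \<Rightarrow> nat \<Rightarrow> relay \<Rightarrow> user set" where
  "users_of H r h = {k \<in> users H r. h \<in> k}"

definition demands :: "nat \<Rightarrow> nat \<Rightarrow> nat \<Rightarrow> demand set" where
  "demands H r N = users H r \<rightarrow>\<^sub>E {1..N}"

definition libraries :: "nat \<Rightarrow> nat \<Rightarrow> library set" where
  "libraries N B = {1..N} \<rightarrow>\<^sub>E {bs. length bs = B}"

(* The uniform distribution on all libraries: all N * B bits are i.i.d. uniform. *)
definition library_pmf :: "nat \<Rightarrow> nat \<Rightarrow> library pmf" where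
  "library_pmf N B = pmf_of_set (libraries N B)"

(* The first argument n of the functions is the index along the sequence of file sizes
   B = file_size S n. The caches are functions of the library, so handing the library to
   the server also hands it the cache contents. The dependence of the loads on the
   placement is implicit, since the placement is a component of the scheme; for each
   scheme and demand vector the message lengths are the same for all file contents. *)
record scheme =
  file_size :: "nat \<Rightarrow> nat"
  cache :: "nat \<Rightarrow> user \<Rightarrow> library \<Rightarrow> bits"
  server_msg :: "nat \<Rightarrow> demand \<Rightarrow> library \<Rightarrow> relay \<Rightarrow> bits"
  relay_msg :: "nat \<Rightarrow> demand \<Rightarrow> relay \<Rightarrow> user \<Rightarrow> bits \<Rightarrow> bits"
  decoder :: "nat \<Rightarrow> demand \<Rightarrow> user \<Rightarrow> bits \<Rightarrow> (relay \<Rightarrow> bits) \<Rightarrow> bits"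
  server_load :: "demand \<Rightarrow> relay \<Rightarrow> real"
  relay_load :: "demand \<Rightarrow> relay \<Rightarrow> user \<Rightarrow> real"

definition forwarded :: "scheme \<Rightarrow> nat \<Rightarrow> demand \<Rightarrow> library \<Rightarrow> relay \<Rightarrow> user \<Rightarrow> bits" where
  "forwarded S n d F h k = relay_msg S n d h k (server_msg S n d F h)"

definition decoded :: "scheme \<Rightarrow> nat \<Rightarrow> demand \<Rightarrow> library \<Rightarrow> user \<Rightarrow> bits" where
  "decoded S n d F k =
     decoder S n d k (cache S n k F) (\<lambda>h\<in>k. forwarded S n d F h k)"

definition error_prob :: "nat \<Rightarrow> nat \<Rightarrow> nat \<Rightarrow> scheme \<Rightarrow> nat \<Rightarrow> demand \<Rightarrow> real" where
  "error_prob H r N S n d =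
     measure_pmf.prob (library_pmf N (file_size S n))
       {F. \<exists>k\<in>users H r. decoded S n d F k \<noteq> F (d k)}"

definition caching_scheme :: "nat \<Rightarrow> nat \<Rightarrow> real \<Rightarrow> nat \<Rightarrow> scheme \<Rightarrow> bool" where
  "caching_scheme H r M N S \<longleftrightarrow>
     (\<forall>n. 0 < file_size S n) \<and>
     filterlim (file_size S) at_top sequentially \<and>
     (\<forall>n. \<forall>F\<in>libraries N (file_size S n).
        (\<forall>k\<in>users H r. real (length (cache S n k F)) \<le> M * real (file_size S n)) \<and>
        (\<forall>d\<in>demands H r N. \<forall>h\<in>relays H.
           real (length (server_msg S n d F h)) = real (file_size S n) * server_load S d h \<and>
           (\<forall>k\<in>users_of H r h.
              real (length (forwarded S n d F h k))
                = real (file_size S n) * relay_load S d h k))) \<and>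
     (\<forall>d\<in>demands H r N. (\<lambda>n. error_prob H r N S n d) \<longlonglongrightarrow> 0)"

definition max_link_load :: "nat \<Rightarrow> nat \<Rightarrow> nat \<Rightarrow> scheme \<Rightarrow> real" where
  "max_link_load H r N S =
     Max ((\<lambda>d. max (Max (server_load S d ` relays H))
                   (Max {relay_load S d h k | h k. h \<in> relays H \<and> k \<in> users_of H r h}))
          ` demands H r N)"

definition R_routing :: "nat \<Rightarrow> nat \<Rightarrow> real \<Rightarrow> nat \<Rightarrow> real" where
  "R_routing H r M N = real (Kc H r 0) * (1 - M / real N) / real H"

definition attains_gain :: "nat \<Rightarrow> nat \<Rightarrow> real \<Rightarrow> nat \<Rightarrow> scheme \<Rightarrow> real \<Rightarrow> bool" where
  "attains_gain H r M N S g \<longleftrightarrow> max_link_load H r N S = R_routing H r M N / g"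

end

theory Submission
  imports Defs "HOL-Algebra.Algebraic_Closure_Type" "HOL-Library.Z2"
begin

text \<open>The pieces of a file are indexed by the sets \<open>W\<close> of \<open>g - 1\<close> users that share a relay, and are
  coded so that a file is determined by any \<open>D\<close> of its pieces, where \<open>D\<close> is the number of those
  \<open>W\<close> whose common relays include a relay of a given user \<open>k\<close>. User \<open>k\<close> caches the pieces with \<open>k \<in> W\<close>, and
  only needs the others with a relay in common with \<open>k\<close>. For such a \<open>W\<close> the set
  \<open>J = W \<union> {k}\<close> of \<open>g\<close> users shares a relay of \<open>k\<close>, and one multicast of the sum over \<open>u \<in> J\<close> of the
  pieces \<open>J - {u}\<close> of the file requested by \<open>u\<close> serves all of \<open>J\<close>. Its bits are split
  evenly among the common relays of \<open>J\<close>; by symmetry all relays get the same load. The two alternating sums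
  count \<open>D\<close> and the cached pieces by inclusion-exclusion over the relays of \<open>k\<close>.\<close>

section \<open>Finite fields of characteristic two and Reed--Solomon codes\<close>

lemma CHAR_bit: "CHAR(bit) = 2"
proof (rule CHAR_eqI)
  have "(of_nat n :: bit) = of_bool (odd n)" for n
    by (induction n) auto
  then show "2 dvd n" if "of_nat n = (0 :: bit)" for n
    using that by (metis of_bool_eq_0_iff)
qed simp

text \<open>For \<open>L > 0\<close> this is the field with \<open>2 ^ L\<close> elements, as the
  fixed points of the \<open>L\<close>-fold Frobenius map. It is a subset of one fixed type because
  \<open>L\<close> grows with the file size.\<close>

definition gf :: "nat \<Rightarrow> bit alg_closure set" where
  "gf L = {x. x ^ (2 ^ L) = x}"

lemma CHAR_gf: "CHAR(bit alg_closure) = 2"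
  by (simp add: CHAR_bit)

lemma gf_add: "x \<in> gf L \<Longrightarrow> y \<in> gf L \<Longrightarrow> x + y \<in> gf L"
  using freshmans_dream'[where ?'a = "bit alg_closure", of "2 ^ L" L x y]
  unfolding CHAR_gf gf_def by simp

lemma gf_mult: "x \<in> gf L \<Longrightarrow> y \<in> gf L \<Longrightarrow> x * y \<in> gf L"
  by (simp add: gf_def power_mult_distrib)

lemma gf_power: "x \<in> gf L \<Longrightarrow> x ^ n \<in> gf L"
  by (induction n) (auto simp: gf_mult, simp add: gf_def)

lemma gf_0: "0 \<in> gf L"
  by (simp add: gf_def power_0_left)

lemma gf_sum: "(\<And>i. i \<in> A \<Longrightarrow> f i \<in> gf L) \<Longrightarrow> sum f A \<in> gf L"
proof (induction A rule: infinite_finite_induct)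
  case (insert a A)
  have "f a \<in> gf L" "sum f A \<in> gf L" using insert by auto
  then show ?case using insert.hyps by (simp add: gf_add)
qed (auto simp: gf_0)

text \<open>The polynomial X^(2^L) - X splits into linear factors over the algebraic closure, and
  its derivative is a nonzero constant. Hence its \<open>2 ^ L\<close> roots are simple and
  therefore distinct.\<close>

lemma card_gf:
  assumes "0 < L"
  shows "finite (gf L)" "card (gf L) = 2 ^ L"
proof -
  define p :: "bit alg_closure poly" where "p = Polynomial.monom 1 (2 ^ L) - Polynomial.monom 1 1"
  have L1: "1 < (2::nat) ^ L" using assms by (intro one_less_power) auto
  have two: "(2 :: bit alg_closure) = 0"
    using of_nat_CHAR[where ?'a = "bit alg_closure"] unfolding CHAR_gf by simp
  have deg: "Polynomial.degree p = 2 ^ L"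
    unfolding p_def using L1 by (subst diff_conv_add_uminus, subst degree_add_eq_left)
      (auto simp: degree_monom_eq)
  have "p \<noteq> 0" using deg L1 by auto
  have lc: "Polynomial.lead_coeff p = 1"
    unfolding deg unfolding p_def using L1 by simp
  obtain A where A: "size A = 2 ^ L" "p = (\<Prod>x\<in>#A. [:-x, 1:])"
    using alg_closed_imp_factorization[OF \<open>p \<noteq> 0\<close>] deg lc by auto
  have root: "poly p x = 0 \<longleftrightarrow> x \<in> gf L" for x
    by (simp add: p_def poly_monom gf_def)
  \<comment> \<open>The factor \<open>2 ^ L\<close> of the leading term's derivative is zero in
    characteristic two, as \<open>L > 0\<close>.\<close>
  have pd: "pderiv p = - 1"
    unfolding p_def using assms
    by (simp add: pderiv_diff pderiv_monom two power_0_left monom_0 flip: one_pCons)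
  have cnt: "count A x \<le> 1" for x
  proof (rule ccontr)
    assume "\<not> count A x \<le> 1"
    then have "{#x, x#} \<subseteq># A"
      by (intro mset_subset_eqI) auto
    then obtain A' where "A = {#x, x#} + A'"
      by (metis mset_subset_eq_exists_conv)
    then have "p = [:-x, 1:] * ([:-x, 1:] * (\<Prod>x\<in>#A'. [:-x, 1:]))"
      using A by simp
    then have "poly (pderiv p) x = 0"
      by (simp only: pderiv_mult poly_add poly_mult) simp
    then show False using pd by simp
  qed
  have set: "set_mset A = gf L"
    by (auto simp: A(2) poly_prod_mset prod_mset_zero_iff simp flip: root)
  show "finite (gf L)" by (simp flip: set)
  have "count A x = (if x \<in># A then 1 else 0)" for x
    using cnt[of x] by (auto simp: not_in_iff) (metis One_nat_def Suc_leI antisym count_greater_zero_iff)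
  then have "size A = card (set_mset A)"
    by (simp add: size_multiset_overloaded_eq)
  then show "card (gf L) = 2 ^ L" using A set by simp
qed

text \<open>Reed--Solomon codes; only the cardinalities of the alphabets matter for passing between
  bit strings and field elements.\<close>

definition mds_code :: "nat \<Rightarrow> nat \<Rightarrow> 'a set \<Rightarrow> (bits \<Rightarrow> 'a \<Rightarrow> bits) \<Rightarrow> bool" where
  "mds_code D L I enc \<longleftrightarrow>
     (\<forall>F w. length F = D * L \<longrightarrow> w \<in> I \<longrightarrow> length (enc F w) = L) \<and>
     (\<forall>F F' A. length F = D * L \<longrightarrow> length F' = D * L \<longrightarrow> A \<subseteq> I \<longrightarrow> card A = D \<longrightarrow>
        (\<forall>w\<in>A. enc F w = enc F' w) \<longrightarrow> F = F')"

text \<open>A file is read as the \<open>D\<close> coefficients of a polynomial of degree below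
  \<open>D\<close>, and piece \<open>w\<close> is its value at the point \<open>pt w\<close>. Values
  at \<open>D\<close> distinct points determine the polynomial; the bound on \<open>card I\<close>
  provides enough points.\<close>

lemma mds_code_exists:
  fixes I :: "'a set"
  assumes "0 < L" "finite I" "card I \<le> 2 ^ L"
  shows "\<exists>enc. mds_code D L I enc"
proof -
  note fin = card_gf(1)[OF assms(1)] and card = card_gf(2)[OF assms(1)]
  have len: "finite {bs::bits. length bs = n}" "card {bs::bits. length bs = n} = 2 ^ n" for n
    using finite_lists_length_eq[of "UNIV :: bool set" n] card_lists_length_eq[of "UNIV :: bool set" n]
    by auto
  have "card ({..<D} \<rightarrow>\<^sub>E gf L) = card {bs::bits. length bs = D * L}"
    by (simp add: card_PiE card len mult.commute flip: power_mult)
  moreover have "finite ({..<D} \<rightarrow>\<^sub>E gf L)" using fin by (intro finite_PiE) auto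
  ultimately obtain \<phi> where \<phi>: "bij_betw \<phi> {bs::bits. length bs = D * L} ({..<D} \<rightarrow>\<^sub>E gf L)"
    using len finite_same_card_bij by metis
  obtain \<psi> where \<psi>: "bij_betw \<psi> (gf L) {bs::bits. length bs = L}"
    using len finite_same_card_bij fin card by metis
  obtain pt where pt: "pt ` I \<subseteq> gf L" "inj_on pt I"
    using assms card fin by (metis card_le_inj)
  define enc where "enc F w = \<psi> (\<Sum>j<D. \<phi> F j * pt w ^ j)" for F w
  have in_gf: "(\<Sum>j<D. \<phi> F j * pt w ^ j) \<in> gf L" if "length F = D * L" "w \<in> I" for F w
  proof -
    have "\<phi> F \<in> {..<D} \<rightarrow>\<^sub>E gf L" using bij_betwE[OF \<phi>] that by auto
    then show ?thesis using that pt by (intro gf_sum gf_mult gf_power) auto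
  qed
  have "mds_code D L I enc"
    unfolding mds_code_def
  proof (intro conjI allI impI)
    show "length (enc F w) = L" if "length F = D * L" "w \<in> I" for F w
      using in_gf[OF that] bij_betwE[OF \<psi>] by (auto simp: enc_def)
  next
    fix F F' :: bits and A
    assume F: "length F = D * L" "length F' = D * L" and A: "A \<subseteq> I" "card A = D"
      and eq: "\<forall>w\<in>A. enc F w = enc F' w"
    define p where "p G = (\<Sum>j<D. Polynomial.monom (\<phi> G j) j)" for G
    have p: "poly (p G) x = (\<Sum>j<D. \<phi> G j * x ^ j)" for G x
      by (simp add: p_def poly_sum poly_monom)
    have coeff: "Polynomial.coeff (p G) j = (if j < D then \<phi> G j else 0)" for G j
      by (simp add: p_def coeff_sum)
    have same: "poly (p F) (pt w) = poly (p F') (pt w)" if "w \<in> A" for w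
      unfolding p using bspec[OF eq that] in_gf[OF F(1)] in_gf[OF F(2)] A that bij_betw_imp_inj_on[OF \<psi>]
      by (auto simp: enc_def inj_on_def)
    have "p F = p F'"
    proof (cases "D = 0")
      case True
      then show ?thesis by (simp add: p_def)
    next
      case False
      have deg: "Polynomial.degree (p G) < D" for G
        using False by (intro degree_lessI) (auto simp: coeff)
      have "card (pt ` A) = D" using A pt by (metis card_image inj_on_subset)
      with deg same show ?thesis by (intro poly_eqI_degree[of "pt ` A"]) auto
    qed
    then have "\<phi> F j = \<phi> F' j" if "j < D" for j
      using coeff that by metis
    moreover have "\<phi> F \<in> {..<D} \<rightarrow>\<^sub>E gf L" "\<phi> F' \<in> {..<D} \<rightarrow>\<^sub>E gf L"
      using bij_betwE[OF \<phi>] F by auto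
    ultimately have "\<phi> F = \<phi> F'" by (intro PiE_ext) auto
    then show "F = F'" using bij_betw_imp_inj_on[OF \<phi>] F by (auto simp: inj_on_def)
  qed
  then show ?thesis by blast
qed

section \<open>Inclusion-exclusion when the size of an intersection depends only on the number of
  sets\<close>

lemma sum_Pow_by_card:
  fixes c :: "nat \<Rightarrow> real"
  assumes "finite A"
  shows "(\<Sum>B | B \<subseteq> A \<and> B \<noteq> {}. c (card B)) = (\<Sum>a=1..card A. real (card A choose a) * c a)"
proof -
  have "card ` {B. B \<subseteq> A \<and> B \<noteq> {}} \<subseteq> {1..card A}"
    using assms by (auto simp: Suc_le_eq card_gt_0_iff finite_subset intro: card_mono)
  then have "(\<Sum>B | B \<subseteq> A \<and> B \<noteq> {}. c (card B)) =
      (\<Sum>a=1..card A. \<Sum>B | B \<in> {B. B \<subseteq> A \<and> B \<noteq> {}} \<and> card B = a. c (card B))"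
    using assms by (intro sum.group[symmetric]) auto
  also have "\<dots> = (\<Sum>a=1..card A. \<Sum>B | B \<subseteq> A \<and> card B = a. c a)"
    by (intro sum.cong) auto
  also have "\<dots> = (\<Sum>a=1..card A. real (card A choose a) * c a)"
    using assms by (simp add: n_subsets)
  finally show ?thesis .
qed

lemma card_UN_by_card:
  fixes c :: "nat \<Rightarrow> real"
  assumes "finite A" "\<And>a. a \<in> A \<Longrightarrow> finite (G a)"
    and "\<And>B. B \<subseteq> A \<Longrightarrow> B \<noteq> {} \<Longrightarrow> real (card (\<Inter>a\<in>B. G a)) = c (card B)"
  shows "real (card (\<Union>a\<in>A. G a)) = (\<Sum>a=1..card A. real (card A choose a) * c a * (-1) ^ (a - 1))"
proof -
  interpret Incl_Excl finite "\<lambda>Y. real (card Y)"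
    by unfold_locales (auto simp: card_Un_disjnt)
  have "real (card (\<Union>a\<in>A. G a)) =
      (\<Sum>B | B \<subseteq> A \<and> B \<noteq> {}. (-1) ^ (card B + 1) * real (card (\<Inter>a\<in>B. G a)))"
    using assms by (intro restricted_indexed) auto
  also have "\<dots> = (\<Sum>B | B \<subseteq> A \<and> B \<noteq> {}. (-1) ^ (card B + 1) * c (card B))"
    using assms by (intro sum.cong) auto
  also have "\<dots> = (\<Sum>a=1..card A. real (card A choose a) * ((-1) ^ (a + 1) * c a))"
    using assms by (intro sum_Pow_by_card)
  also have "\<dots> = (\<Sum>a=1..card A. real (card A choose a) * c a * (-1) ^ (a - 1))"
  proof (intro sum.cong refl)
    \<comment> \<open>As \<open>a\<close> is at least 1, the truncated exponent \<open>a - 1\<close>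
      has the same parity as \<open>a + 1\<close>.\<close>
    fix a assume "a \<in> {1..card A}"
    then obtain m where "a = Suc m" by (cases a) auto
    then show "real (card A choose a) * ((-1) ^ (a + 1) * c a) =
        real (card A choose a) * c a * (-1) ^ (a - 1)"
      by simp
  qed
  finally show ?thesis .
qed

section \<open>Counting users and groups of users with a common relay\<close>

lemma finite_relays [simp]: "finite (relays H)" "card (relays H) = H"
  by (auto simp: relays_def)

lemma finite_users [simp]: "finite (users H r)"
  by (auto simp: users_def intro: finite_subset[of _ "Pow (relays H)"])

lemma card_users: "card (users H r) = Kc H r 0"
  by (simp add: users_def n_subsets Kc_def)

lemma finite_user: "k \<in> users H r \<Longrightarrow> finite k"
  by (auto simp: users_def intro: finite_subset[of _ "relays H"])

text \<open>Removing \<open>I\<close> leaves an arbitrary set of \<open>r - card I\<close> of the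
  other relays. If \<open>card I\<close> exceeded \<open>r\<close>, the left side would be 0, but
  truncated subtraction would make the right side 1.\<close>

lemma card_users_superset:
  assumes "I \<subseteq> relays H" "card I \<le> r"
  shows "card {u \<in> users H r. I \<subseteq> u} = Kc H r (card I)"
proof -
  have fI: "finite I" using assms(1) by (rule finite_subset) simp
  have "bij_betw (\<lambda>u. u - I) {u \<in> users H r. I \<subseteq> u} {v. v \<subseteq> relays H - I \<and> card v = r - card I}"
  proof (rule bij_betw_byWitness[where f' = "\<lambda>v. v \<union> I"])
    show "(\<lambda>u. u - I) ` {u \<in> users H r. I \<subseteq> u} \<subseteq> {v. v \<subseteq> relays H - I \<and> card v = r - card I}"
      using fI by (auto simp: users_def card_Diff_subset)
    show "(\<lambda>v. v \<union> I) ` {v. v \<subseteq> relays H - I \<and> card v = r - card I} \<subseteq> {u \<in> users H r. I \<subseteq> u}"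
    proof safe
      fix v assume v: "v \<subseteq> relays H - I" "card v = r - card I"
      then have "finite v" "v \<inter> I = {}" by (auto intro: finite_subset[of _ "relays H"])
      then have "card (v \<union> I) = r" using v fI assms by (simp add: card_Un_disjoint)
      then show "v \<union> I \<in> users H r" using v assms by (auto simp: users_def)
    qed
  qed auto
  then have "card {u \<in> users H r. I \<subseteq> u} = card {v. v \<subseteq> relays H - I \<and> card v = r - card I}"
    by (rule bij_betw_same_card)
  then show ?thesis
    using assms fI by (simp add: n_subsets card_Diff_subset Kc_def)
qed

text \<open>With \<open>A = relays H\<close> these index all the pieces (\<open>n = g - 1\<close>)
  and all the multicasts (\<open>n = g\<close>); with \<open>A = k\<close> and
  \<open>n = g - 1\<close>, the pieces from which user \<open>k\<close> decodes.\<close>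

definition groups :: "nat \<Rightarrow> nat \<Rightarrow> relay set \<Rightarrow> nat \<Rightarrow> user set set" where
  "groups H r A n = {W. W \<subseteq> users H r \<and> card W = n \<and> (\<exists>h\<in>A. \<forall>u\<in>W. h \<in> u)}"

lemma finite_groups [simp]: "finite (groups H r A n)"
  by (auto simp: groups_def intro: finite_subset[of _ "Pow (users H r)"])

lemma groups_mono: "A \<subseteq> B \<Longrightarrow> groups H r A n \<subseteq> groups H r B n"
  by (auto simp: groups_def)

text \<open>The union runs over the relays \<open>h\<close> of \<open>k\<close>. The groups that
  share all relays of \<open>I\<close> are the \<open>(g - 1)\<close>-subsets of the
  \<open>Kc H r (card I)\<close> users containing \<open>I\<close>. The value is the same for every
  \<open>k\<close>.\<close>

lemma card_groups_user:
  assumes "k \<in> users H r" "1 \<le> g"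
  shows "real (card (groups H r k (g - 1))) =
    (\<Sum>a=1..r. real (r choose a) * real (binom0 (int (Kc H r a)) (int g - 1)) * (-1) ^ (a - 1))"
proof -
  define G where "G h = {W. W \<subseteq> {u \<in> users H r. h \<in> u} \<and> card W = g - 1}" for h
  have k: "finite k" "card k = r" "k \<subseteq> relays H"
    using assms finite_user[OF assms(1)] by (auto simp: users_def)
  have U: "groups H r k (g - 1) = (\<Union>h\<in>k. G h)"
    by (auto simp: groups_def G_def)
  have "real (card (\<Union>h\<in>k. G h)) =
      (\<Sum>a=1..card k. real (card k choose a) * real (binom0 (int (Kc H r a)) (int g - 1)) * (-1) ^ (a - 1))"
  proof (rule card_UN_by_card)
    fix I assume I: "I \<subseteq> k" "I \<noteq> {}"
    have "(\<Inter>h\<in>I. G h) = {W. W \<subseteq> {u \<in> users H r. I \<subseteq> u} \<and> card W = g - 1}"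
      using I by (auto simp: G_def)
    then have "card (\<Inter>h\<in>I. G h) = Kc H r (card I) choose (g - 1)"
      using I k card_users_superset[of I H r] card_mono[of k I] by (simp add: n_subsets)
    then show "real (card (\<Inter>h\<in>I. G h)) =
        real (binom0 (int (Kc H r (card I))) (int g - 1))"
      using assms k by (simp add: binom0_def nat_diff_distrib) linarith
  qed (auto simp: G_def k)
  then show ?thesis by (simp only: U k)
qed

lemma card_subsets_containing:
  assumes "finite A" "x \<in> A"
  shows "card {W. W \<subseteq> A \<and> x \<in> W \<and> card W = Suc n} = (card A - 1) choose n"
proof -
  have "bij_betw (insert x) {W. W \<subseteq> A - {x} \<and> card W = n} {W. W \<subseteq> A \<and> x \<in> W \<and> card W = Suc n}"
  proof (rule bij_betw_byWitness[where f' = "\<lambda>W. W - {x}"])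
    show "insert x ` {W. W \<subseteq> A - {x} \<and> card W = n} \<subseteq> {W. W \<subseteq> A \<and> x \<in> W \<and> card W = Suc n}"
    proof safe
      fix W assume "W \<subseteq> A - {x}"
      then have "finite W" "x \<notin> W" using assms by (auto intro: finite_subset)
      then show "card (insert x W) = Suc (card W)" by simp
    qed (use assms in auto)
  qed auto
  then have "card {W. W \<subseteq> A \<and> x \<in> W \<and> card W = Suc n} = card {W. W \<subseteq> A - {x} \<and> card W = n}"
    by (rule bij_betw_same_card[symmetric])
  then show ?thesis
    using assms by (simp add: n_subsets)
qed

text \<open>The same inclusion-exclusion with \<open>k\<close> as a forced member: the other
  \<open>g - 2\<close> members come from the remaining \<open>Kc H r a - 1\<close> users.\<close>

lemma card_groups_user_containing:
  assumes "k \<in> users H r" "1 \<le> g"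
  shows "real (card {W \<in> groups H r k (g - 1). k \<in> W}) =
    (\<Sum>a=1..r. real (r choose a) * real (binom0 (int (Kc H r a) - 1) (int g - 2)) * (-1) ^ (a - 1))"
proof -
  define G where "G h = {W. W \<subseteq> {u \<in> users H r. h \<in> u} \<and> k \<in> W \<and> card W = g - 1}" for h
  have k: "finite k" "card k = r" "k \<subseteq> relays H"
    using assms finite_user[OF assms(1)] by (auto simp: users_def)
  have U: "{W \<in> groups H r k (g - 1). k \<in> W} = (\<Union>h\<in>k. G h)"
    by (auto simp: groups_def G_def)
  have "real (card (\<Union>h\<in>k. G h)) =
      (\<Sum>a=1..card k. real (card k choose a) * real (binom0 (int (Kc H r a) - 1) (int g - 2)) * (-1) ^ (a - 1))"
  proof (rule card_UN_by_card)
    fix I assume I: "I \<subseteq> k" "I \<noteq> {}"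
    have eq: "(\<Inter>h\<in>I. G h) = {W. W \<subseteq> {u \<in> users H r. I \<subseteq> u} \<and> k \<in> W \<and> card W = g - 1}"
      using I by (auto simp: G_def)
    have kI: "k \<in> {u \<in> users H r. I \<subseteq> u}" using I assms by auto
    have c: "card {u \<in> users H r. I \<subseteq> u} = Kc H r (card I)"
      using I k card_users_superset[of I H r] card_mono[of k I] by simp
    \<comment> \<open>User \<open>k\<close> itself contains \<open>I\<close>, so subtracting 1 gives
      the same result on naturals and integers.\<close>
    then have pos: "0 < Kc H r (card I)"
      using kI card_gt_0_iff[of "{u \<in> users H r. I \<subseteq> u}"] by auto
    show "real (card (\<Inter>h\<in>I. G h)) =
        real (binom0 (int (Kc H r (card I)) - 1) (int g - 2))"
    proof (cases "g = 1")
      case True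
      \<comment> \<open>For \<open>g = 1\<close> the lower index of \<open>binom0\<close> is -1,
        giving 0. On the left, \<open>card W = 0\<close> forces \<open>W\<close> to be empty only
        once infinite sets are excluded.\<close>
      have "finite W" if "W \<subseteq> {u \<in> users H r. I \<subseteq> u}" for W
        using that by (rule finite_subset) simp
      then have "(\<Inter>h\<in>I. G h) = {}"
        unfolding eq True by (auto simp: card_eq_0_iff)
      then show ?thesis using True by (simp add: binom0_def)
    next
      case False
      then obtain n where n: "g = Suc (Suc n)" using assms(2)
        by (metis One_nat_def Suc_le_D not0_implies_Suc)
      have "card (\<Inter>h\<in>I. G h) = (Kc H r (card I) - 1) choose n"
        unfolding eq using card_subsets_containing[OF _ kI, of n] by (simp add: n c)
      then show ?thesis using k pos by (auto simp: binom0_def n nat_diff_distrib)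
    qed
  qed (auto simp: G_def k)
  then show ?thesis by (simp only: U k)
qed

text \<open>Both sides count pairs of a multicast group \<open>J\<close> and a member
  \<open>k\<close>. Deleting \<open>k\<close> from \<open>J\<close> is reversible, since any common
  relay of \<open>J\<close> is a relay of \<open>k\<close>.\<close>

lemma double_count_groups:
  assumes "0 < g"
  shows "g * card (groups H r (relays H) g) =
    (\<Sum>k\<in>users H r. card {W \<in> groups H r k (g - 1). k \<notin> W})"
proof -
  let ?J = "groups H r (relays H) g"
  have fin: "finite W" if "W \<subseteq> users H r" for W using that by (rule finite_subset) simp
  have "g * card ?J = (\<Sum>J\<in>?J. card {k \<in> users H r. k \<in> J})"
  proof -
    have "card {k \<in> users H r. k \<in> J} = g" if "J \<in> ?J" for J
    proof -
      have "{k \<in> users H r. k \<in> J} = J" using that by (auto simp: groups_def)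
      then show ?thesis using that by (auto simp: groups_def)
    qed
    then show ?thesis by simp
  qed
  also have "\<dots> = (\<Sum>k\<in>users H r. card {J \<in> ?J. k \<in> J})"
    by (rule sum_multicount_gen) auto
  also have "\<dots> = (\<Sum>k\<in>users H r. card {W \<in> groups H r k (g - 1). k \<notin> W})"
  proof (intro sum.cong refl)
    fix k assume k: "k \<in> users H r"
    have "bij_betw (insert k) {W \<in> groups H r k (g - 1). k \<notin> W} {J \<in> ?J. k \<in> J}"
    proof (rule bij_betw_byWitness[where f' = "\<lambda>W. W - {k}"])
      show "insert k ` {W \<in> groups H r k (g - 1). k \<notin> W} \<subseteq> {J \<in> ?J. k \<in> J}"
        using k assms fin by (auto simp: groups_def users_def subset_iff)
      show "(\<lambda>W. W - {k}) ` {J \<in> ?J. k \<in> J} \<subseteq> {W \<in> groups H r k (g - 1). k \<notin> W}"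
        using k assms fin by (auto simp: groups_def)
    qed auto
    then show "card {J \<in> ?J. k \<in> J} = card {W \<in> groups H r k (g - 1). k \<notin> W}"
      by (rule bij_betw_same_card[symmetric])
  qed
  finally show ?thesis .
qed

section \<open>Even distribution of the multicast bits over the relays\<close>

text \<open>The transposition of \<open>h\<close> and \<open>h'\<close> permutes the relays, hence
  the users and the groups, and preserves the number of common relays of a group.\<close>

lemma sum_groups_relay_eq:
  assumes h: "h \<in> relays H" "h' \<in> relays H"
  shows "(\<Sum>J | J \<in> groups H r (relays H) n \<and> h \<in> \<Inter>J. f (card (\<Inter>J))) =
    (\<Sum>J | J \<in> groups H r (relays H) n \<and> h' \<in> \<Inter>J. f (card (\<Inter>J)))"
proof -
  define \<pi> where "\<pi> = id(h := h', h' := h)"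
  define T where "T J = (`) \<pi> ` J" for J :: "user set"
  have \<pi>: "\<And>x. \<pi> (\<pi> x) = x" "\<pi> h = h'" "\<pi> h' = h"
    by (auto simp: \<pi>_def)
  have \<pi>_rel: "\<pi> x \<in> relays H \<longleftrightarrow> x \<in> relays H" for x
    using h by (auto simp: \<pi>_def)
  have \<pi>\<pi>: "\<pi> ` \<pi> ` u = u" for u using \<pi>(1) by (force simp: image_iff)
  have inj: "inj_on \<pi> u" for u using \<pi>(1) by (metis inj_on_inverseI)
  have TT: "T (T J) = J" for J
  proof -
    have "T (T J) = (\<lambda>u. \<pi> ` \<pi> ` u) ` J" by (auto simp: T_def)
    then show ?thesis unfolding \<pi>\<pi> by simp
  qed
  have imem: "x \<in> \<pi> ` A \<longleftrightarrow> \<pi> x \<in> A" for x A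
    by (metis image_iff \<pi>(1))
  have user: "\<pi> ` u \<in> users H r" if "u \<in> users H r" for u
  proof -
    have "\<pi> ` u \<subseteq> relays H" using that by (auto simp: users_def \<pi>_rel)
    then show ?thesis using that by (simp add: users_def card_image[OF inj])
  qed
  have mem: "x \<in> \<Inter>(T J) \<longleftrightarrow> \<pi> x \<in> \<Inter>J" for x J
    by (simp add: T_def imem)
  have Int: "\<Inter>(T J) = \<pi> ` \<Inter>J" for J
    by (rule Set.set_eqI) (simp only: mem imem)
  have group: "T J \<in> groups H r (relays H) n" if J: "J \<in> groups H r (relays H) n" for J
  proof -
    have "inj_on ((`) \<pi>) J"
      by (metis \<pi>\<pi> inj_on_inverseI)
    then have "card (T J) = n" using J by (simp add: T_def card_image groups_def)
    moreover have "T J \<subseteq> users H r" using J user by (auto simp: T_def groups_def)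
    moreover obtain x where "x \<in> relays H" "\<forall>u\<in>J. x \<in> u" using J by (auto simp: groups_def)
    then have "\<pi> x \<in> relays H" "\<forall>u\<in>T J. \<pi> x \<in> u" by (auto simp: T_def \<pi>_rel)
    ultimately show ?thesis by (auto simp: groups_def)
  qed
  show ?thesis
    by (rule sum.reindex_bij_witness[where i = T and j = T])
      (simp_all add: TT group imem mem \<pi> Int card_image[OF inj] del: Inter_iff)
qed

lemma card_residue_class:
  assumes "c dvd L" "j < c"
  shows "card {i. i < L \<and> i mod c = (j::nat)} = L div c"
proof -
  have "bij_betw (\<lambda>q. q * c + j) {..<L div c} {i. i < L \<and> i mod c = j}"
  proof (rule bij_betw_byWitness[where f' = "\<lambda>i. i div c"])
    show "(\<lambda>q. q * c + j) ` {..<L div c} \<subseteq> {i. i < L \<and> i mod c = j}"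
    proof safe
      fix q assume "q < L div c"
      then have "Suc q * c \<le> L div c * c" by (intro mult_right_mono) auto
      then show "q * c + j < L" using assms by simp
    qed (use assms in auto)
    show "(\<lambda>i. i div c) ` {i. i < L \<and> i mod c = j} \<subseteq> {..<L div c}"
    proof safe
      fix i assume "i < L"
      then have "i < L div c * c" using assms by simp
      then show "i div c < L div c" by (rule less_mult_imp_div_less)
    qed
    show "\<forall>q\<in>{..<L div c}. (q * c + j) div c = q"
      using assms(2) by simp
    show "\<forall>i\<in>{i. i < L \<and> i mod c = j}. i div c * c + j = i"
      by auto
  qed
  from bij_betw_same_card[OF this] show ?thesis by simp
qed

text \<open>Round-robin assignment: positions are dealt to the elements of \<open>A\<close> by their
  residue modulo \<open>card A\<close>.\<close>

lemma fair_owner: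
  assumes "finite A" "A \<noteq> {}" "card A dvd L"
  obtains own :: "nat \<Rightarrow> 'a" where "\<And>i. own i \<in> A"
    "\<And>h. h \<in> A \<Longrightarrow> card {i. i < L \<and> own i = h} = L div card A"
proof -
  obtain e where e: "bij_betw e {..<card A} A"
    using assms(1) by (metis ex_bij_betw_nat_finite atLeast0LessThan)
  have pos: "0 < card A" using assms by (simp add: card_gt_0_iff)
  show thesis
  proof (rule that[of "\<lambda>i. e (i mod card A)"])
    show "e (i mod card A) \<in> A" for i using bij_betwE[OF e] pos by auto
    fix h assume "h \<in> A"
    then obtain j where j: "j < card A" "h = e j"
      using e by (auto simp: bij_betw_def)
    then have "{i. i < L \<and> e (i mod card A) = h} = {i. i < L \<and> i mod card A = j}"
      using bij_betw_imp_inj_on[OF e] pos by (auto simp: inj_on_def)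
    then show "card {i. i < L \<and> e (i mod card A) = h} = L div card A"
      using card_residue_class[OF assms(3) j(1)] by simp
  qed
qed

text \<open>\<open>own J i\<close> is the relay that carries bit \<open>i\<close> of the multicast
  for \<open>J\<close>, so it must reach every member of \<open>J\<close>. The second clause gives
  each relay the fraction 1/H of all bits, multiplied out to stay in the naturals.\<close>

definition balanced :: "nat \<Rightarrow> nat \<Rightarrow> nat \<Rightarrow> nat \<Rightarrow> (user set \<Rightarrow> nat \<Rightarrow> relay) \<Rightarrow> bool" where
  "balanced H r n L own \<longleftrightarrow>
     (\<forall>J\<in>groups H r (relays H) n. \<forall>i. own J i \<in> \<Inter>J) \<and>
     (\<forall>h\<in>relays H. H * card {(J, i). J \<in> groups H r (relays H) n \<and> i < L \<and> own J i = h}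
        = card (groups H r (relays H) n) * L)"

text \<open>A group has at most \<open>r\<close> common relays, so their number divides
  \<open>fact r\<close> and hence \<open>L\<close>, and each multicast splits evenly among them. By
  symmetry all relays then carry equally many bits, and these \<open>H\<close> equal numbers sum to
  the total.\<close>

lemma balanced_exists:
  assumes "0 < n" "fact r dvd L"
  shows "\<exists>own. balanced H r n L own"
proof -
  let ?G = "groups H r (relays H) n"
  have Int: "finite (\<Inter>J)" "\<Inter>J \<noteq> {}" "card (\<Inter>J) dvd L" "\<Inter>J \<subseteq> relays H" if J: "J \<in> ?G" for J
  proof -
    \<comment> \<open>An empty \<open>J\<close> would have intersection \<open>UNIV\<close>;
      \<open>0 < n\<close> excludes it.\<close>
    have "J \<noteq> {}" using J assms(1) by (auto simp: groups_def)
    then obtain u where u: "u \<in> J" "u \<in> users H r" using J by (auto simp: groups_def)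
    then show "finite (\<Inter>J)" using finite_user[OF u(2)] by (meson Inter_lower finite_subset)
    show "\<Inter>J \<noteq> {}" using J by (auto simp: groups_def)
    show "\<Inter>J \<subseteq> relays H" using u by (auto simp: users_def)
    have "card (\<Inter>J) \<le> r"
      using u card_mono[OF finite_user[OF u(2)] Inter_lower[OF u(1)]] by (simp add: users_def)
    moreover have "0 < card (\<Inter>J)"
      using \<open>finite (\<Inter>J)\<close> \<open>\<Inter>J \<noteq> {}\<close> by (simp add: card_gt_0_iff)
    ultimately have "card (\<Inter>J) dvd fact r" by (intro dvd_fact) auto
    then show "card (\<Inter>J) dvd L" using assms(2) by (rule dvd_trans)
  qed
  have "\<forall>J\<in>?G. \<exists>own. (\<forall>i. own i \<in> \<Inter>J) \<and>
      (\<forall>h\<in>\<Inter>J. card {i. i < L \<and> own i = h} = L div card (\<Inter>J))"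
    using fair_owner[OF Int(1-3)] by metis
  from bchoice[OF this] obtain own where
    "\<forall>J\<in>?G. (\<forall>i. own J i \<in> \<Inter>J) \<and>
      (\<forall>h\<in>\<Inter>J. card {i. i < L \<and> own J i = h} = L div card (\<Inter>J))" ..
  then have own: "\<And>J i. J \<in> ?G \<Longrightarrow> own J i \<in> \<Inter>J"
      "\<And>J h. J \<in> ?G \<Longrightarrow> h \<in> \<Inter>J \<Longrightarrow> card {i. i < L \<and> own J i = h} = L div card (\<Inter>J)"
    by blast+
  define P where "P h = {(J, i). J \<in> ?G \<and> i < L \<and> own J i = h}" for h
  have finP: "finite (P h)" for h
    by (rule finite_subset[of _ "?G \<times> {..<L}"]) (auto simp: P_def)
  have P: "card (P h) = (\<Sum>J | J \<in> ?G \<and> h \<in> \<Inter>J. L div card (\<Inter>J))" for h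
  proof -
    have "P h = (SIGMA J:{J \<in> ?G. h \<in> \<Inter>J}. {i. i < L \<and> own J i = h})"
      unfolding P_def using own(1) by (intro Set.set_eqI) (auto simp del: Inter_iff)
    then have "card (P h) = (\<Sum>J\<in>{J \<in> ?G. h \<in> \<Inter>J}. card {i. i < L \<and> own J i = h})"
      by simp
    also have "\<dots> = (\<Sum>J\<in>{J \<in> ?G. h \<in> \<Inter>J}. L div card (\<Inter>J))"
      using own(2) by (intro sum.cong) auto
    finally show ?thesis by simp
  qed
  have "H * card (P h) = card ?G * L" if h: "h \<in> relays H" for h
  proof -
    have "card (P h') = card (P h)" if "h' \<in> relays H" for h'
      unfolding P using sum_groups_relay_eq[OF that h] .
    then have "H * card (P h) = (\<Sum>h'\<in>relays H. card (P h'))" by simp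
    also have "\<dots> = card (\<Union>h'\<in>relays H. P h')"
      using finP by (intro card_UN_disjoint[symmetric]) (auto simp: P_def)
    also have "(\<Union>h'\<in>relays H. P h') = ?G \<times> {..<L}"
      unfolding P_def using own(1) Int(4)
      by (intro Set.set_eqI) (auto simp del: Inter_iff, blast)
    finally show ?thesis by simp
  qed
  then have "H * card {(J, i). J \<in> ?G \<and> i < L \<and> own J i = h} = card ?G * L"
    if "h \<in> relays H" for h
    using that unfolding P_def .
  with own(1) have "balanced H r n L own"
    unfolding balanced_def by (intro conjI ballI allI)
  then show ?thesis by blast
qed

section \<open>Decoding from cached pieces and multicasts\<close>

text \<open>The order depends on the set alone, so a position in a transmitted or cached list means
  the same bit for every library.\<close>

definition enum_list :: "'a set \<Rightarrow> 'a list" where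
  "enum_list A = (SOME xs. set xs = A \<and> distinct xs)"

lemma enum_list:
  assumes "finite A"
  shows "set (enum_list A) = A" "length (enum_list A) = card A"
proof -
  have "set (enum_list A) = A \<and> distinct (enum_list A)"
    unfolding enum_list_def using finite_distinct_list[OF assms] by (rule someI_ex)
  then show "set (enum_list A) = A" "length (enum_list A) = card A"
    using distinct_card by fastforce+
qed

lemma finite_libraries: "finite (libraries N B)" "libraries N B \<noteq> {}"
proof -
  have "finite {bs::bits. length bs = B}"
    using finite_lists_length_eq[of "UNIV :: bool set" B] by simp
  then show "finite (libraries N B)" by (auto simp: libraries_def intro: finite_PiE)
  have "replicate B True \<in> {bs. length bs = B}" by simp
  then show "libraries N B \<noteq> {}"
    unfolding libraries_def PiE_eq_empty_iff by blast
qed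

text \<open>The exclusive or of the members' bits, written as the parity of a count.\<close>

definition multicast_bit :: "(bits \<Rightarrow> user set \<Rightarrow> bits) \<Rightarrow> demand \<Rightarrow> library \<Rightarrow> user set \<Rightarrow> nat \<Rightarrow> bool" where
  "multicast_bit enc d F J i = odd (\<Sum>u\<in>J. of_bool (enc (F (d u)) (J - {u}) ! i) :: nat)"

text \<open>Decodability is stated as injectivity: libraries that look alike to user
  \<open>k\<close> agree on the requested file. For an uncached \<open>W\<close>, all other summands
  of the multicast to \<open>insert k W\<close> are pieces containing \<open>k\<close>, hence
  cached, so the piece \<open>W\<close> is determined. This yields \<open>D\<close> pieces, enough
  for the code.\<close>

lemma recover_file:
  fixes enc :: "bits \<Rightarrow> user set \<Rightarrow> bits"
  assumes code: "mds_code D L (groups H r (relays H) n) enc"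
    and k: "k \<in> users H r" "card (groups H r k n) = D"
    and d: "d \<in> demands H r N"
    and F: "F \<in> libraries N (D * L)" "F' \<in> libraries N (D * L)"
    and cached: "\<And>f W i. f \<in> {1..N} \<Longrightarrow> W \<in> groups H r k n \<Longrightarrow> k \<in> W \<Longrightarrow> i < L
      \<Longrightarrow> enc (F f) W ! i = enc (F' f) W ! i"
    and received: "\<And>J i. J \<in> groups H r (relays H) (Suc n) \<Longrightarrow> k \<in> J \<Longrightarrow> i < L
      \<Longrightarrow> multicast_bit enc d F J i = multicast_bit enc d F' J i"
  shows "F (d k) = F' (d k)"
proof -
  have len: "length (enc F w) = L" if "length F = D * L" "w \<in> groups H r (relays H) n" for F w
    using code that unfolding mds_code_def by blast
  have kr: "k \<subseteq> relays H" using k by (auto simp: users_def)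
  then have sub: "groups H r k n \<subseteq> groups H r (relays H) n" by (rule groups_mono)
  have dk: "d u \<in> {1..N}" if "u \<in> users H r" for u
    using d that by (auto simp: demands_def)
  have lenF: "length (F (d k)) = D * L" "length (F' (d k)) = D * L"
    using F dk[OF k(1)] by (auto simp: libraries_def PiE_iff)
  have "enc (F (d k)) W = enc (F' (d k)) W" if W: "W \<in> groups H r k n" for W
  proof (rule nth_equalityI)
    show "length (enc (F (d k)) W) = length (enc (F' (d k)) W)"
      using len lenF W sub by auto
    fix i assume "i < length (enc (F (d k)) W)"
    then have i: "i < L" using len lenF W sub by auto
    show "enc (F (d k)) W ! i = enc (F' (d k)) W ! i"
    proof (cases "k \<in> W")
      case True
      then show ?thesis using cached dk[OF k(1)] W i by auto
    next
      case False
      have finW: "finite W" using W by (auto simp: groups_def intro: finite_subset[OF _ finite_users])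
      have J: "insert k W \<in> groups H r (relays H) (Suc n)"
        using W k kr finW False by (auto simp: groups_def)
      \<comment> \<open>The summand for \<open>u = k\<close> is the wanted piece \<open>W\<close>,
        since \<open>insert k W - {k} = W\<close>.\<close>
      have split: "multicast_bit enc d G (insert k W) i \<longleftrightarrow>
          (enc (G (d k)) W ! i \<noteq> odd (\<Sum>u\<in>W. of_bool (enc (G (d u)) (insert k W - {u}) ! i) :: nat))" for G
      proof -
        have "insert k W - {k} = W" using False by auto
        then show ?thesis
          unfolding multicast_bit_def sum.insert[OF finW False] by (cases "enc (G (d k)) W ! i") simp_all
      qed
      have "enc (F (d u)) (insert k W - {u}) ! i = enc (F' (d u)) (insert k W - {u}) ! i"
        if u: "u \<in> W" for u
      proof (rule cached)
        show "d u \<in> {1..N}" using dk W u by (auto simp: groups_def)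
        show "k \<in> insert k W - {u}" using u False by auto
        show "insert k W - {u} \<in> groups H r k n"
          using W k u finW False by (auto simp: groups_def)
      qed fact
      then have "(\<Sum>u\<in>W. of_bool (enc (F (d u)) (insert k W - {u}) ! i) :: nat) =
          (\<Sum>u\<in>W. of_bool (enc (F' (d u)) (insert k W - {u}) ! i))"
        by (intro sum.cong) auto
      then show ?thesis
        using received[OF J _ i] split[of F] split[of F'] by auto
    qed
  qed
  then show ?thesis
    using code lenF sub k(2) unfolding mds_code_def by blast
qed

section \<open>Loads, error probability and construction of the scheme\<close>

lemma max_link_load_const:
  assumes "0 < H" "0 < r" "r \<le> H" "0 < N"
    and "\<And>d h. server_load S d h = c" "\<And>d h k. relay_load S d h k = c"
  shows "max_link_load H r N S = c"
proof -
  have rel: "1 \<in> relays H" using assms by (auto simp: relays_def)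
  \<comment> \<open>Some user at relay 1 is needed, so that the maximum over relay-to-user links is
    not over an empty set.\<close>
  then have "r - 1 \<le> card (relays H - {1})" using assms by simp
  then obtain v where v: "v \<subseteq> relays H - {1}" "card v = r - 1"
    by (rule obtain_subset_with_card_n)
  have "finite v" "1 \<notin> v" using v by (auto intro: finite_subset[of _ "relays H"])
  then have "insert 1 v \<in> users_of H r 1"
    using v rel assms by (auto simp: users_of_def users_def)
  then have "{relay_load S d h k | h k. h \<in> relays H \<and> k \<in> users_of H r h} = {c}" for d
    using rel assms by auto
  moreover have "server_load S d ` relays H = {c}" for d
    using rel assms by auto
  moreover have "demands H r N \<noteq> {}"
    using assms by (auto simp: demands_def PiE_eq_empty_iff)
  ultimately show ?thesis
    by (simp add: max_link_load_def image_constant_conv)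
qed

lemma error_prob_eq_0:
  assumes "\<And>F k. F \<in> libraries N (file_size S n) \<Longrightarrow> k \<in> users H r \<Longrightarrow> decoded S n d F k = F (d k)"
  shows "error_prob H r N S n d = 0"
proof -
  have "set_pmf (library_pmf N (file_size S n)) = libraries N (file_size S n)"
    unfolding library_pmf_def using finite_libraries by (intro set_pmf_of_set)
  then show ?thesis
    unfolding error_prob_def using assms by (subst measure_pmf_zero_iff) auto
qed

lemma Kc_absorb:
  assumes "0 < r" "r \<le> H"
  shows "r * Kc H r 0 = H * Kc H r 1"
  using assms times_binomial_minus1_eq[of r H] by (simp add: Kc_def)

text \<open>Relays forward everything they receive: the max-link load depends only on the larger of the
  two kinds of loads, so nothing is gained by forwarding less.\<close>

lemma scheme_exists:
  assumes pos: "0 < H" "0 < N" "0 < D" "0 < n"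
    and card: "\<And>k. k \<in> users H r \<Longrightarrow> card (groups H r k (n - 1)) = D"
      "\<And>k. k \<in> users H r \<Longrightarrow> card {W \<in> groups H r k (n - 1). k \<in> W} = C"
    and c: "c = real (card (groups H r (relays H) n)) / (real H * real D)"
  obtains S where "caching_scheme H r (real N * (real C / real D)) N S"
    "\<And>d h. server_load S d h = c" "\<And>d h k. relay_load S d h k = c"
proof -
  let ?W = "groups H r (relays H) (n - 1)" and ?J = "groups H r (relays H) n"
  \<comment> \<open>The factor \<open>fact r\<close> makes the even splitting possible,
    \<open>card ?W\<close> makes the field large enough for one evaluation point per piece,
    \<open>t\<close> makes the file size unbounded, and the 1 makes it positive.\<close>
  define L where "L t = fact r * (t + card ?W + 1)" for t
  have L: "0 < L t" "fact r dvd L t" "t \<le> L t" "card ?W \<le> 2 ^ L t" for t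
  proof -
    have ge: "1 * (t + card ?W + 1) \<le> L t"
      unfolding L_def by (intro mult_right_mono) (auto simp: fact_ge_1)
    then show "0 < L t" "t \<le> L t" by simp_all
    have "card ?W \<le> L t" using ge by simp
    also have "L t \<le> 2 ^ L t" using less_exp by (rule less_imp_le)
    finally show "card ?W \<le> 2 ^ L t" .
    show "fact r dvd L t" by (simp add: L_def)
  qed
  have "\<exists>enc. mds_code D (L t) ?W enc" for t
    using L by (intro mds_code_exists) auto
  then obtain enc where enc: "\<And>t. mds_code D (L t) ?W (enc t)" by metis
  have "\<exists>own. balanced H r n (L t) own" for t
    using balanced_exists[OF pos(4) L(2)] .
  then obtain own where "\<And>t. balanced H r n (L t) (own t)" by metis
  note own = this[unfolded balanced_def, THEN conjunct1, rule_format]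
    this[unfolded balanced_def, THEN conjunct2, rule_format]
  \<comment> \<open>\<open>P t h\<close> indexes the multicast bits sent to relay \<open>h\<close>,
    and \<open>Q t k\<close> the bits of all files cached by user \<open>k\<close>.\<close>
  define P where "P t h = {(J, i). J \<in> ?J \<and> i < L t \<and> own t J i = h}" for t h
  define Q where "Q t k = {1..N} \<times> {W \<in> groups H r k (n - 1). k \<in> W} \<times> {..<L t}" for t k
  have finP: "finite (P t h)" for t h
    by (rule finite_subset[of _ "?J \<times> {..<L t}"]) (auto simp: P_def)
  have finQ: "finite (Q t k)" for t k by (simp add: Q_def)
  define ca where "ca t k F = map (\<lambda>(f, W, i). enc t (F f) W ! i) (enum_list (Q t k))"
    for t k and F :: library
  define sm where "sm t d F h = map (\<lambda>(J, i). multicast_bit (enc t) d F J i) (enum_list (P t h))"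
    for t d F h
  \<comment> \<open>The decoder picks any library consistent with the cache and the received
    messages; by \<open>recover_file\<close> its file \<open>d k\<close> is the right one.\<close>
  define de where "de t d k z x =
      (SOME F. F \<in> libraries N (D * L t) \<and> ca t k F = z \<and> (\<lambda>h\<in>k. sm t d F h) = x) (d k)"
    for t d k z x
  define S where "S = \<lparr>file_size = \<lambda>t. D * L t, cache = ca, server_msg = sm,
      relay_msg = \<lambda>t d h k x. x, decoder = de, server_load = \<lambda>d h. c, relay_load = \<lambda>d h k. c\<rparr>"
  have load: "real (length (sm t d F h)) = real (D * L t) * c" if "h \<in> relays H" for t d F h
  proof -
    have "H * card (P t h) = card ?J * L t"
      unfolding P_def by (rule own(2)[OF that])
    then have "real H * real (card (P t h)) = real (card ?J) * real (L t)"
      by (simp only: flip: of_nat_mult)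
    then show ?thesis
      using pos by (simp add: sm_def enum_list finP c field_simps)
  qed
  have mem: "real (length (ca t k F)) = real N * (real C / real D) * real (D * L t)"
    if "k \<in> users H r" for t k F
    using pos card(2)[OF that] by (simp add: ca_def enum_list[OF finQ]) (simp add: Q_def)
  have dec: "decoded S t d F k = F (d k)"
    if F: "F \<in> libraries N (D * L t)" and k: "k \<in> users H r" and d: "d \<in> demands H r N" for t d F k
  proof -
    define F' where "F' = (SOME G. G \<in> libraries N (D * L t) \<and> ca t k G = ca t k F
      \<and> (\<lambda>h\<in>k. sm t d G h) = (\<lambda>h\<in>k. sm t d F h))"
    have *: "F' \<in> libraries N (D * L t) \<and> ca t k F' = ca t k F
      \<and> (\<lambda>h\<in>k. sm t d F' h) = (\<lambda>h\<in>k. sm t d F h)"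
      unfolding F'_def by (rule someI[of _ F]) (use F in auto)
    then have F': "F' \<in> libraries N (D * L t)" "ca t k F' = ca t k F" by simp_all
    have F'_sm: "sm t d F' h = sm t d F h" if "h \<in> k" for h
      using fun_cong[OF conjunct2[OF conjunct2[OF *]], of h] that by simp
    have "F' (d k) = F (d k)"
    proof (rule recover_file[OF enc k card(1)[OF k] d F'(1) F])
      show "enc t (F' f) W ! i = enc t (F f) W ! i"
        if "f \<in> {1..N}" "W \<in> groups H r k (n - 1)" "k \<in> W" "i < L t" for f W i
      proof -
        have "(f, W, i) \<in> set (enum_list (Q t k))" using that by (simp add: enum_list finQ) (simp add: Q_def)
        then show ?thesis using F'(2) unfolding ca_def map_eq_conv by blast
      qed
      show "multicast_bit (enc t) d F' J i = multicast_bit (enc t) d F J i"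
        if J: "J \<in> groups H r (relays H) (Suc (n - 1))" "k \<in> J" "i < L t" for J i
      proof -
        have J': "J \<in> ?J" using J pos by simp
        \<comment> \<open>The carrying relay is common to all of \<open>J\<close>, so it is
          connected to \<open>k\<close>.\<close>
        have h: "own t J i \<in> k" using own(1)[OF J'] J by blast
        have "(J, i) \<in> set (enum_list (P t (own t J i)))"
          using J' J by (simp add: enum_list finP) (simp add: P_def)
        then show ?thesis using F'_sm[OF h] unfolding sm_def map_eq_conv by blast
      qed
    qed
    then show ?thesis
      by (simp add: decoded_def forwarded_def S_def de_def F'_def)
  qed
  have "caching_scheme H r (real N * (real C / real D)) N S"
    unfolding caching_scheme_def
  proof (intro conjI allI ballI)
    show "0 < file_size S t" for t using pos L by (simp add: S_def)
    have "t \<le> file_size S t" for t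
      using pos L(3)[of t] mult_le_mono[of 1 D t "L t"] by (simp add: S_def)
    then show "filterlim (file_size S) at_top sequentially"
      by (intro filterlim_at_top_mono[OF filterlim_ident]) auto
    show "(\<lambda>t. error_prob H r N S t d) \<longlonglongrightarrow> 0" if "d \<in> demands H r N" for d
    proof -
      have "error_prob H r N S t d = 0" for t
        by (rule error_prob_eq_0) (use dec that in \<open>auto simp: S_def\<close>)
      then show ?thesis by simp
    qed
  qed (use mem load in \<open>auto simp: S_def forwarded_def\<close>)
  then show thesis by (rule that) (auto simp: S_def)
qed

section \<open>Evaluation of the cache size and the load\<close>

theorem theorem1:
  fixes H r N g :: nat and M :: real
  assumes "0 < H" and "0 < r" and "r \<le> H" and "0 < N"
    and "1 \<le> g" and "g \<le> Kc H r 1"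
    and "M = real N *
      ((\<Sum>a=1..r. real (r choose a) * real (binom0 (int (Kc H r a) - 1) (int g - 2)) * (-1) ^ (a - 1)) /
       (\<Sum>a=1..r. real (r choose a) * real (binom0 (int (Kc H r a)) (int g - 1)) * (-1) ^ (a - 1)))"
  shows "combination_network H r M N \<and>
    (\<exists>S. caching_scheme H r M N S \<and>
         attains_gain H r M N S (real g) \<and>
         max_link_load H r N S = 1 / real g * (real (Kc H r 1) * (1 - M / real N) / real r))"
proof -
  have "0 < card (users H r)"
    using assms(3) by (simp add: card_users Kc_def)
  \<comment> \<open>\<open>k0\<close> is only a reference user: the counts \<open>D\<close> and
    \<open>C\<close> do not depend on the choice of user.\<close>
  then obtain k0 where k0: "k0 \<in> users H r"
    by (metis card_gt_0_iff ex_in_conv)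
  define D where "D = card (groups H r k0 (g - 1))"
  define C where "C = card {W \<in> groups H r k0 (g - 1). k0 \<in> W}"
  have D: "card (groups H r k (g - 1)) = D" if "k \<in> users H r" for k
  proof -
    have "real (card (groups H r k (g - 1))) = real D"
      unfolding D_def card_groups_user[OF that assms(5)] card_groups_user[OF k0 assms(5)] ..
    then show ?thesis by (simp only: of_nat_eq_iff)
  qed
  have C: "card {W \<in> groups H r k (g - 1). k \<in> W} = C" if "k \<in> users H r" for k
  proof -
    have "real (card {W \<in> groups H r k (g - 1). k \<in> W}) = real C"
      unfolding C_def card_groups_user_containing[OF that assms(5)]
        card_groups_user_containing[OF k0 assms(5)] ..
    then show ?thesis by (simp only: of_nat_eq_iff)
  qed
  have M: "M = real N * (real C / real D)"
    unfolding assms(7) C_def D_def card_groups_user[OF k0 assms(5)]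
      card_groups_user_containing[OF k0 assms(5)] ..
  have "C \<le> D" unfolding C_def D_def by (rule card_mono) auto
  \<comment> \<open>A relay of \<open>k0\<close> has \<open>Kc H r 1\<close> users, and
    \<open>g - 1\<close> of them form a group.\<close>
  have "0 < D"
  proof -
    have "k0 \<noteq> {}" using k0 assms(2) by (auto simp: users_def)
    then obtain h where h: "h \<in> k0" by auto
    then have "card {u \<in> users H r. {h} \<subseteq> u} = Kc H r 1"
      using k0 assms(2) by (subst card_users_superset) (auto simp: users_def)
    then have "g - 1 \<le> card {u \<in> users H r. {h} \<subseteq> u}" using assms(6) by simp
    then obtain W where "W \<subseteq> {u \<in> users H r. {h} \<subseteq> u}" "card W = g - 1"
      by (rule obtain_subset_with_card_n)
    then have "W \<in> groups H r k0 (g - 1)" using h by (auto simp: groups_def)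
    then show ?thesis unfolding D_def by (auto simp: card_gt_0_iff)
  qed
  define c where "c = real (card (groups H r (relays H) g)) / (real H * real D)"
  have "card {W \<in> groups H r k (g - 1). k \<notin> W} = D - C" if k: "k \<in> users H r" for k
  proof -
    have "{W \<in> groups H r k (g - 1). k \<notin> W} =
        groups H r k (g - 1) - {W \<in> groups H r k (g - 1). k \<in> W}" by auto
    then show ?thesis using D[OF k] C[OF k] by (simp add: card_Diff_subset)
  qed
  then have "g * card (groups H r (relays H) g) = Kc H r 0 * (D - C)"
    using assms(5) by (simp add: double_count_groups card_users)
  then have "real g * real (card (groups H r (relays H) g)) = real (Kc H r 0) * (real D - real C)"
    using \<open>C \<le> D\<close> by (metis of_nat_diff of_nat_mult)
  \<comment> \<open>Here \<open>1 - M / N = (D - C) / D\<close>, so the double count turns the load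
    \<open>c\<close> into the routing load divided by \<open>g\<close>.\<close>
  then have c: "c = R_routing H r M N / real g"
    using assms(1,4,5) \<open>0 < D\<close> by (simp add: c_def R_routing_def M field_simps)
  \<comment> \<open>The two forms of the routing load agree by the absorption identity for binomial
    coefficients.\<close>
  have routing: "R_routing H r M N = real (Kc H r 1) * (1 - M / real N) / real r"
  proof -
    have "real r * real (Kc H r 0) = real H * real (Kc H r 1)"
      using Kc_absorb[OF assms(2,3)] by (metis of_nat_mult)
    then have "real (Kc H r 0) / real H = real (Kc H r 1) / real r"
      using assms(1,2) by (simp add: field_simps)
    then show ?thesis by (simp add: R_routing_def) (metis times_divide_eq_left)
  qed
  obtain S where S: "caching_scheme H r (real N * (real C / real D)) N S"
    "\<And>d h. server_load S d h = c" "\<And>d h k. relay_load S d h k = c"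
    using scheme_exists[OF assms(1,4) \<open>0 < D\<close> _ D C c_def] assms(5) by auto
  have load: "max_link_load H r N S = c"
    using max_link_load_const[OF assms(1-4) S(2,3)] .
  have "combination_network H r M N"
    using assms(1-4) \<open>C \<le> D\<close> \<open>0 < D\<close>
    by (simp add: combination_network_def M divide_le_eq)
  moreover have "attains_gain H r M N S (real g)"
    by (simp add: attains_gain_def load c)
  moreover have "max_link_load H r N S = 1 / real g * (real (Kc H r 1) * (1 - M / real N) / real r)"
    unfolding load c routing by simp
  ultimately show ?thesis using S(1) unfolding M by blast
qed

end
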